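(* Let $X$ be a vector space with semi-norm $\|\cdot\|_X$, let $C\subseteq X$, and let $\{T_t\}_{t\ge0}$ be a semigroup of mappings $T_t:C\to C$. Suppose there are a second vector space $Y$ with semi-norm $\|\cdot\|_Y$ and constants $M,\gamma,\delta>0$ and $\hat\omega\in\mathbb{R}$ such that $$\|T_tu_0\|_X\le M\,e^{\hat\omega t}\,\frac{\|u_0\|_Y^\gamma}{t^\delta}\qquad\text{for every }t>0\text{ and }u_0\in C\cap Y .$$ If for some $\alpha\neq1$, $\omega,\omega_F\in\mathbb{R}$ and $L\ge1$, $\{T_t\}_{t\ge0}$ satisfies $$\limsup_{h\to0+}\frac{\|T_{t+h}u_0-T_tu_0\|_X}{h}\le\frac{e^{\omega t}}{t}\frac{L}{|1-\alpha|}\left[b(t)+L\omega_F\int_0^tb(s)\,e^{L\omega_F(t-s)}\,ds\right]\|u_0\|_X$$ for a.e. $t>0$ and every $u_0\in C$, where $b(t):=2+\omega_FL\int_0^te^{\omega_Fs}\,ds$, then $$\limsup_{h\to0+}\frac{\|T_{t+h}u_0-T_tu_0\|_X}{h}\le\frac{2^{\delta+1}e^{\frac{\omega+\hat\omega}{2}t}}{t^{\delta+1}}\frac{LM}{|1-\alpha|}\left[b(\tfrac t2)+L\omega_F\int_0^{\frac t2}b(s)\,e^{L\omega_F(\frac t2-s)}\,ds\right]\|u_0\|_Y^\gamma$$ for a.e. $t>0$ and every $u_0\in C$. In particular, for such $t$ and $u_0$, if the right-hand side derivative $\frac{d}{dt}_{+}T_tu_0$ exists (in $X$) at $t$, then $$\left\|\frac{dT_tu_0}{dt}_{+}\right\|_X\le\frac{2^{\delta+1}e^{\frac{\omega+\hat\omega}{2}t}}{t^{\delta+1}}\frac{LM}{|1-\alpha|}\left[b(\tfrac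 t2)+L\omega_F\int_0^{\frac t2}b(s)\,e^{L\omega_F(\frac t2-s)}\,ds\right]\|u_0\|_Y^\gamma .$$
   Context: Semigroup means $T_{t+s}=T_tT_s$ for all $t,s\ge0$. "For a.e. $t>0$ and every $u_0\in C$" means that, outside a Lebesgue null set of $t$, the inequality holds for all $u_0\in C$. For $u_0\in C\setminus Y$ the convention is $\|u_0\|_Y=+\infty$, so that the conclusion is trivial in that case.
   Formalization: Added hypothesis: if ω_F<0 and ‖·‖_X vanishes on all of C, then ‖·‖_Y vanishes on C∩Y; without it the bracket is negative for large t and the claim fails (e.g. X=Y=C=ℝ, ‖·‖_X=0, ‖·‖_Y=|·|, T_t=id, L=1, ω_F=-1). *)

theory Defs
  imports "HOL-Analysis.Analysis"
begin

definition seminorm_on :: "'v::real_vector set \<Rightarrow> ('v \<Rightarrow> real) \<Rightarrow> bool" where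
  "seminorm_on S p \<longleftrightarrow>
     (\<forall>x\<in>S. 0 \<le> p x) \<and>
     (\<forall>x\<in>S. \<forall>c. p (c *\<^sub>R x) = \<bar>c\<bar> * p x) \<and>
     (\<forall>x\<in>S. \<forall>y\<in>S. p (x + y) \<le> p x + p y)"

(* Only the composition law is required; T 0 need not be the identity on C. *)
definition semigroup_on :: "'v set \<Rightarrow> (real \<Rightarrow> 'v \<Rightarrow> 'v) \<Rightarrow> bool" where
  "semigroup_on C T \<longleftrightarrow>
     (\<forall>t\<ge>0. T t \<in> C \<rightarrow> C) \<and>
     (\<forall>t\<ge>0. \<forall>s\<ge>0. \<forall>u\<in>C. T (t + s) u = T t (T s u))"

(* Values in the extended reals, since the upper limit may be infinite. *)
definition upper_right_speed ::
  "('v::real_vector \<Rightarrow> real) \<Rightarrow> (real \<Rightarrow> 'v) \<Rightarrow> real \<Rightarrow> ereal" where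
  "upper_right_speed p f t = Limsup (at_right 0) (\<lambda>h. ereal (p (f (t + h) - f t) / h))"

(* A relation rather than a function: p is only a semi-norm, so the right derivative is
   determined only up to elements of semi-norm zero. *)
definition has_right_derivative_on ::
  "'v::real_vector set \<Rightarrow> ('v \<Rightarrow> real) \<Rightarrow> (real \<Rightarrow> 'v) \<Rightarrow> 'v \<Rightarrow> real \<Rightarrow> bool" where
  "has_right_derivative_on S p f v t \<longleftrightarrow>
     v \<in> S \<and> ((\<lambda>h. p ((1 / h) *\<^sub>R (f (t + h) - f t) - v)) \<longlongrightarrow> 0) (at_right 0)"

definition b_fun :: "real \<Rightarrow> real \<Rightarrow> real \<Rightarrow> real" where
  "b_fun L \<omega>\<^sub>F t = 2 + \<omega>\<^sub>F * L * integral {0..t} (\<lambda>s. exp (\<omega>\<^sub>F * s))"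

definition bracket :: "real \<Rightarrow> real \<Rightarrow> real \<Rightarrow> real" where
  "bracket L \<omega>\<^sub>F t =
     b_fun L \<omega>\<^sub>F t
     + L * \<omega>\<^sub>F * integral {0..t} (\<lambda>s. b_fun L \<omega>\<^sub>F s * exp (L * \<omega>\<^sub>F * (t - s)))"

(* K * (semi-norm of u in Y) powr gamma, where the semi-norm is infinite outside Y. There the
   bound is infinite whatever the sign of K, so that it is trivially satisfied. *)
definition ext_bound ::
  "real \<Rightarrow> 'v set \<Rightarrow> ('v \<Rightarrow> real) \<Rightarrow> real \<Rightarrow> 'v \<Rightarrow> ereal" where
  "ext_bound K Y p \<gamma> u = (if u \<in> Y then ereal (K * p u powr \<gamma>) else \<infinity>)"

(* For negative \<omega>\<^sub>F the bracket is negative for large t, as this instance shows. If moreover the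
   semi-norm of X vanishes on all of C, then both assumed estimates read 0 \<le> 0, whereas the
   asserted one reads 0 \<le> (negative number) * (semi-norm of u in Y) powr gamma and fails as soon
   as some u in both C and Y has nonzero semi-norm in Y. (Example: L = 1, \<omega>\<^sub>F = -1, C = X = Y the
   real line with semi-norms 0 and the absolute value, T t the identity.) The theorem carries a
   hypothesis excluding exactly this configuration; it holds automatically if \<omega>\<^sub>F \<ge> 0, if some
   element of C has nonzero semi-norm in X, or if the semi-norm of X is a norm. *)
lemma bracket_1_minus_1:
  assumes "0 \<le> t"
  shows "bracket 1 (- 1) t = (2 - t) * exp (- t)"
proof -
  have b: "b_fun 1 (- 1) r = 1 + exp (- r)" if "0 \<le> r" for r
  proof -
    have "((\<lambda>s. exp (- s)) has_integral (- exp (- r)) - (- exp (- 0))) {0..r}"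
      by (rule fundamental_theorem_of_calculus[OF that])
         (auto intro!: derivative_eq_intros
               simp: has_real_derivative_iff_has_vector_derivative[symmetric])
    then show ?thesis
      by (simp add: b_fun_def integral_unique)
  qed
  have "((\<lambda>s. (1 + exp (- s)) * exp (- (t - s))) has_integral
          (exp (t - t) + t * exp (- t)) - (exp (0 - t) + 0 * exp (- t))) {0..t}"
    by (rule fundamental_theorem_of_calculus[OF assms])
       (auto intro!: derivative_eq_intros
             simp: has_real_derivative_iff_has_vector_derivative[symmetric] algebra_simps
             simp flip: exp_add)
  then have "integral {0..t} (\<lambda>s. (1 + exp (- s)) * exp (- (t - s)))
      = 1 + t * exp (- t) - exp (- t)"
    by (simp add: integral_unique)
  moreover have "integral {0..t} (\<lambda>s. b_fun 1 (- 1) s * exp (- (t - s)))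
      = integral {0..t} (\<lambda>s. (1 + exp (- s)) * exp (- (t - s)))"
    by (rule integral_cong) (simp add: b)
  ultimately show ?thesis
    using b[OF assms] by (simp add: bracket_def algebra_simps)
qed

end

theory Submission
  imports Defs
begin

text \<open>
  By the semigroup law, the orbit of \<open>u\<close> near time \<open>t\<close> is the orbit of \<open>w = T (t / 2) u\<close> near
  time \<open>t / 2\<close>, so both have the same upper right speed there (\<open>upper_right_speed_semigroup\<close>).
  The regularity estimate at time \<open>t / 2\<close> bounds this speed by a multiple of the semi-norm of
  \<open>w\<close> in \<open>X\<close>, which the smoothing estimate at time \<open>t / 2\<close> bounds by a multiple of the
  \<open>\<gamma>\<close>-th power of the semi-norm of \<open>u\<close> in \<open>Y\<close>; the exceptional null set is merely dilated by
  the factor 2 (\<open>AE_lebesgue_half\<close>).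

  Chaining the two estimates requires a nonnegative bracket. If the bracket at \<open>t / 2\<close> is
  negative, then \<open>\<omega>\<^sub>F < 0\<close> (\<open>bracket_nonneg\<close>), and since speeds are nonnegative the regularity
  estimate forces the semi-norm of \<open>X\<close> to vanish on \<open>C\<close>. By nondegeneracy the semi-norm of \<open>Y\<close>
  vanishes on \<open>C \<inter> Y\<close>, so that the bound on the speed from regularity and the asserted
  bound are both 0.

  Finally the semi-norm of a right derivative is at most the upper right speed, by the
  triangle inequality (\<open>right_derivative_le_upper_right_speed\<close>).
\<close>

lemma seminorm_onD:
  assumes "seminorm_on S p" and "x \<in> S"
  shows "0 \<le> p x" and "p (c *\<^sub>R x) = \<bar>c\<bar> * p x"
    and "y \<in> S \<Longrightarrow> p (x + y) \<le> p x + p y"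
  using assms by (auto simp: seminorm_on_def)

lemma semigroup_onD:
  assumes "semigroup_on C T" and "0 \<le> t" and "u \<in> C"
  shows "T t u \<in> C" and "0 \<le> s \<Longrightarrow> T (t + s) u = T t (T s u)"
  using assms by (auto simp: semigroup_on_def)

lemma AE_lebesgue_half:
  fixes P :: "real \<Rightarrow> bool"
  assumes "AE t in lebesgue. P t"
  shows "AE t in lebesgue. P (t / 2)"
proof -
  obtain N where N: "N \<in> null_sets lebesgue" "{t. \<not> P t} \<subseteq> N"
    using assms by (auto simp: eventually_ae_filter)
  have "negligible ((\<lambda>t. 2 *\<^sub>R t) ` N)"
    using N(1)
    by (intro negligible_differentiable_image_negligible)
      (auto simp: negligible_iff_null_sets intro!: derivative_intros)
  moreover have "t \<in> (\<lambda>t. 2 *\<^sub>R t) ` N" if "\<not> P (t / 2)" for t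
    using that N(2) by (intro image_eqI[where x = "t / 2"]) auto
  ultimately show ?thesis
    by (intro AE_I'[where N = "(\<lambda>t. 2 *\<^sub>R t) ` N"]) (auto simp: negligible_iff_null_sets)
qed

lemma bracket_nonneg:
  assumes "0 \<le> L" and "0 \<le> \<omega>\<^sub>F"
  shows "0 \<le> bracket L \<omega>\<^sub>F t"
proof -
  have integral_ge_0: "0 \<le> integral S f" if "\<And>s. 0 \<le> f s" for S and f :: "real \<Rightarrow> real"
    using that by (cases "f integrable_on S") (auto intro: integral_nonneg simp: not_integrable_integral)
  have "0 \<le> b_fun L \<omega>\<^sub>F s" for s
    unfolding b_fun_def using assms by (intro add_nonneg_nonneg mult_nonneg_nonneg integral_ge_0) auto
  then show ?thesis
    unfolding bracket_def using assms
    by (intro add_nonneg_nonneg mult_nonneg_nonneg integral_ge_0) auto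
qed

lemma upper_right_speed_nonneg:
  assumes "\<And>h. 0 < h \<Longrightarrow> 0 \<le> p (f (t + h) - f t)"
  shows "0 \<le> upper_right_speed p f t"
  unfolding upper_right_speed_def
proof (rule le_Limsup)
  show "\<forall>\<^sub>F h in at_right 0. 0 \<le> ereal (p (f (t + h) - f t) / h)"
    using eventually_at_right_less[of 0] by eventually_elim (use assms in auto)
qed simp

lemma upper_right_speed_semigroup:
  assumes "semigroup_on C T" and "0 \<le> r" and "0 \<le> s" and "u \<in> C"
  shows "upper_right_speed p (\<lambda>t. T t u) (r + s) = upper_right_speed p (\<lambda>t. T t (T s u)) r"
  unfolding upper_right_speed_def
proof (rule Limsup_eq)
  show "\<forall>\<^sub>F h in at_right 0. ereal (p (T (r + s + h) u - T (r + s) u) / h)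
          = ereal (p (T (r + h) (T s u) - T r (T s u)) / h)"
    using eventually_at_right_less[of 0]
  proof eventually_elim
    case (elim h)
    have "T (r + s + h) u = T (r + h + s) u"
      by (simp add: algebra_simps)
    then show ?case
      using elim assms semigroup_onD(2)[of C T "r + h" u s] semigroup_onD(2)[of C T r u s]
      by simp
  qed
qed

lemma right_derivative_le_upper_right_speed:
  assumes "subspace S" and p: "seminorm_on S p"
    and f: "\<And>s. t \<le> s \<Longrightarrow> f s \<in> S"
    and v: "has_right_derivative_on S p f v t"
  shows "ereal (p v) \<le> upper_right_speed p f t"
proof -
  define q where "q h = (1 / h) *\<^sub>R (f (t + h) - f t)" for h
  have vS: "v \<in> S" and lim: "((\<lambda>h. p (q h - v)) \<longlongrightarrow> 0) (at_right 0)"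
    using v by (auto simp: has_right_derivative_on_def q_def)
  have "((\<lambda>h. ereal (p v - p (q h - v))) \<longlongrightarrow> ereal (p v - 0)) (at_right 0)"
    by (intro tendsto_intros lim)
  from lim_imp_Limsup[OF _ this]
  have "ereal (p v) = Limsup (at_right 0) (\<lambda>h. ereal (p v - p (q h - v)))"
    by simp
  also have "\<dots> \<le> upper_right_speed p f t"
    unfolding upper_right_speed_def
  proof (rule Limsup_mono)
    show "\<forall>\<^sub>F h in at_right 0.
            ereal (p v - p (q h - v)) \<le> ereal (p (f (t + h) - f t) / h)"
      using eventually_at_right_less[of 0]
    proof eventually_elim
      case (elim h)
      have dS: "f (t + h) - f t \<in> S"
        using elim f \<open>subspace S\<close> by (auto intro: subspace_diff)
      then have qS: "q h \<in> S"
        using \<open>subspace S\<close> by (simp add: q_def subspace_scale)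
      then have "v - q h \<in> S"
        using vS \<open>subspace S\<close> by (auto intro: subspace_diff)
      then have "p (q h - v) = p (v - q h)" and "p v \<le> p (v - q h) + p (q h)"
        using seminorm_onD(2)[OF p, of "v - q h" "- 1"] seminorm_onD(3)[OF p _ qS, of "v - q h"]
        by auto
      moreover have "p (q h) = p (f (t + h) - f t) / h"
        using elim seminorm_onD(2)[OF p dS] by (simp add: q_def)
      ultimately show ?case
        by simp
    qed
  qed
  finally show ?thesis .
qed

theorem corollary2p8:
  fixes X Y C :: "'v::real_vector set"
    and normX normY :: "'v \<Rightarrow> real"
    and T :: "real \<Rightarrow> 'v \<Rightarrow> 'v"
    and M \<gamma> \<delta> \<omega>' \<alpha> \<omega> \<omega>\<^sub>F L :: real
  assumes "subspace X" and "seminorm_on X normX"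
    and "C \<subseteq> X"
    and "semigroup_on C T"
    and "subspace Y" and "seminorm_on Y normY"
    and "M > 0" and "\<gamma> > 0" and "\<delta> > 0"
    and smoothing: "\<forall>t>0. \<forall>u\<in>C \<inter> Y.
      normX (T t u) \<le> M * exp (\<omega>' * t) * (normY u powr \<gamma> / t powr \<delta>)"
    and "\<alpha> \<noteq> 1" and "L \<ge> 1"
    and regularity: "AE t in lebesgue. t > 0 \<longrightarrow> (\<forall>u\<in>C.
      upper_right_speed normX (\<lambda>s. T s u) t
        \<le> ereal (exp (\<omega> * t) / t * (L / \<bar>1 - \<alpha>\<bar>) * bracket L \<omega>\<^sub>F t * normX u))"
    and nondegenerate: "\<omega>\<^sub>F < 0 \<and> (\<forall>u\<in>C. normX u = 0) \<longrightarrow> (\<forall>u\<in>C \<inter> Y. normY u = 0)"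
  shows "AE t in lebesgue. t > 0 \<longrightarrow> (\<forall>u\<in>C.
      let K = 2 powr (\<delta> + 1) * exp ((\<omega> + \<omega>') / 2 * t) / t powr (\<delta> + 1)
                * (L * M / \<bar>1 - \<alpha>\<bar>) * bracket L \<omega>\<^sub>F (t / 2)
      in upper_right_speed normX (\<lambda>s. T s u) t \<le> ext_bound K Y normY \<gamma> u
         \<and> (\<forall>v. has_right_derivative_on X normX (\<lambda>s. T s u) v t
                  \<longrightarrow> ereal (normX v) \<le> ext_bound K Y normY \<gamma> u))"
proof -
  have speed_nonneg: "0 \<le> upper_right_speed normX (\<lambda>s. T s u) t" if "0 < t" "u \<in> C" for t u
  proof (rule upper_right_speed_nonneg)
    fix h :: real assume "0 < h"
    then have "T (t + h) u - T t u \<in> X"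
      using that \<open>C \<subseteq> X\<close> semigroup_onD(1)[OF \<open>semigroup_on C T\<close> _ \<open>u \<in> C\<close>]
      by (intro subspace_diff[OF \<open>subspace X\<close>]) auto
    then show "0 \<le> normX (T (t + h) u - T t u)"
      using \<open>seminorm_on X normX\<close> by (rule seminorm_onD(1)[rotated])
  qed
  from AE_lebesgue_half[OF regularity] show ?thesis
  proof eventually_elim
    case (elim t)
    show ?case
    proof (intro impI ballI)
      fix u assume "0 < t" and "u \<in> C"
      define A where "A = exp (\<omega> * (t / 2)) / (t / 2) * (L / \<bar>1 - \<alpha>\<bar>)"
      define B where "B = bracket L \<omega>\<^sub>F (t / 2)"
      define w where "w = T (t / 2) u"
      define K where "K = 2 powr (\<delta> + 1) * exp ((\<omega> + \<omega>') / 2 * t) / t powr (\<delta> + 1)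
                * (L * M / \<bar>1 - \<alpha>\<bar>) * bracket L \<omega>\<^sub>F (t / 2)"
      have "0 < A"
        using \<open>0 < t\<close> \<open>L \<ge> 1\<close> \<open>\<alpha> \<noteq> 1\<close> by (simp add: A_def)
      have "w \<in> C"
        using \<open>0 < t\<close> \<open>u \<in> C\<close> by (simp add: w_def semigroup_onD(1)[OF \<open>semigroup_on C T\<close>])
      have regular: "upper_right_speed normX (\<lambda>s. T s z) (t / 2) \<le> ereal (A * B * normX z)"
        if "z \<in> C" for z
        using elim \<open>0 < t\<close> that by (simp add: A_def B_def)
      have speed_eq: "upper_right_speed normX (\<lambda>s. T s u) t
          = upper_right_speed normX (\<lambda>s. T s w) (t / 2)"
        using upper_right_speed_semigroup[OF \<open>semigroup_on C T\<close>, of "t / 2" "t / 2" u normX]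
          \<open>0 < t\<close> \<open>u \<in> C\<close> by (simp add: w_def)
      have bound: "upper_right_speed normX (\<lambda>s. T s u) t \<le> ext_bound K Y normY \<gamma> u"
      proof (cases "u \<in> Y")
        case False
        then show ?thesis
          by (simp add: ext_bound_def)
      next
        case True
        have "A * B * normX w \<le> K * normY u powr \<gamma>"
        proof (cases "0 \<le> B")
          case True
          have "A * B * normX w
              \<le> A * B * (M * exp (\<omega>' * (t / 2)) * (normY u powr \<gamma> / (t / 2) powr \<delta>))"
            using smoothing[rule_format, of "t / 2" u] \<open>0 < t\<close> \<open>u \<in> C\<close> \<open>u \<in> Y\<close> \<open>0 < A\<close> True
            unfolding w_def by (intro mult_left_mono) auto
          also have "\<dots> = K * normY u powr \<gamma>"
          proof -
            have "exp ((\<omega> + \<omega>') / 2 * t) = exp (\<omega> * (t / 2)) * exp (\<omega>' * (t / 2))"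
              by (simp add: algebra_simps add_divide_distrib flip: exp_add)
            then show ?thesis
              using \<open>0 < t\<close> by (simp add: A_def B_def K_def powr_divide powr_add mult_ac)
          qed
          finally show ?thesis .
        next
          case False
          \<comment> \<open>a negative multiple of a semi-norm bounds a nonnegative speed, for every point of \<open>C\<close>\<close>
          have normX_0: "normX z = 0" if "z \<in> C" for z
          proof -
            have "ereal 0 \<le> ereal (A * B * normX z)"
              using order_trans[OF speed_nonneg[of "t / 2" z] regular[OF that]] \<open>0 < t\<close> that
              by (simp add: zero_ereal_def)
            then have "normX z \<le> 0"
              using False \<open>0 < A\<close> by (simp add: zero_le_mult_iff)
            moreover have "0 \<le> normX z"
              using seminorm_onD(1)[OF \<open>seminorm_on X normX\<close>] that \<open>C \<subseteq> X\<close> by auto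
            ultimately show ?thesis
              by simp
          qed
          have "\<omega>\<^sub>F < 0"
            using False bracket_nonneg[of L \<omega>\<^sub>F "t / 2"] \<open>L \<ge> 1\<close> unfolding B_def by linarith
          then have "normY u = 0"
            using nondegenerate normX_0 \<open>u \<in> C\<close> \<open>u \<in> Y\<close> by blast
          then show ?thesis
            using normX_0[OF \<open>w \<in> C\<close>] by simp
        qed
        then show ?thesis
          using order_trans[OF regular[OF \<open>w \<in> C\<close>], of "ereal (K * normY u powr \<gamma>)"] True
          by (simp add: speed_eq ext_bound_def)
      qed
      have "ereal (normX v) \<le> ext_bound K Y normY \<gamma> u"
        if "has_right_derivative_on X normX (\<lambda>s. T s u) v t" for v
      proof -
        have "T s u \<in> X" if "t \<le> s" for s
          using that \<open>0 < t\<close> \<open>u \<in> C\<close> \<open>C \<subseteq> X\<close> semigroup_onD(1)[OF \<open>semigroup_on C T\<close>, of s u]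
          by auto
        then have "ereal (normX v) \<le> upper_right_speed normX (\<lambda>s. T s u) t"
          by (rule right_derivative_le_upper_right_speed
              [OF \<open>subspace X\<close> \<open>seminorm_on X normX\<close> _ that])
        with bound show ?thesis
          by (rule order_trans[rotated])
      qed
      with bound show "let K = 2 powr (\<delta> + 1) * exp ((\<omega> + \<omega>') / 2 * t) / t powr (\<delta> + 1)
                * (L * M / \<bar>1 - \<alpha>\<bar>) * bracket L \<omega>\<^sub>F (t / 2)
          in upper_right_speed normX (\<lambda>s. T s u) t \<le> ext_bound K Y normY \<gamma> u
            \<and> (\<forall>v. has_right_derivative_on X normX (\<lambda>s. T s u) v t
                  \<longrightarrow> ereal (normX v) \<le> ext_bound K Y normY \<gamma> u)"
        unfolding Let_def K_def by blast
    qed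
  qed
qed

end
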